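(* Let $k>0$, let $A\in\mathbb{C}^{m\times n}$ be $k$-Hadamard, and let $v\in\mathbb{C}^n$ be non-zero. Then for any $1\le q\le\infty$, \[ \|v\|_1\,\|Av\|_1\ \ge\ k^{1-1/q}\,\|v\|_q\,\|Av\|_q . \]
   Context: A matrix $A\in\mathbb{C}^{m\times n}$ is called $k$-Hadamard (for a real number $k>0$) if every entry of $A$ has absolute value at most $1$ and $\|A^*Av\|_\infty\ge k\|v\|_\infty$ for all $v\in\mathbb{C}^n$. Here $\|u\|_q=(\sum_i|u_i|^q)^{1/q}$ for $q<\infty$, $\|u\|_\infty=\max_i|u_i|$, and $1/\infty=0$. *)

theory Defs
  imports "HOL-Analysis.Analysis"
begin

text \<open>The exponent ranges over the extended reals, with \<open>q = \<infinity>\<close> giving the maximum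
  norm. The library's \<open>infnorm\<close> is not the right notion on complex vectors: it takes the maximum
  over real and imaginary parts instead of over absolute values of entries. The definition is
  intended for \<open>q > 0\<close> only.\<close>

definition lq_norm :: "ereal \<Rightarrow> complex ^ 'n \<Rightarrow> real" where
  "lq_norm q u =
    (if q = \<infinity> then Max (range (\<lambda>i. cmod (u $ i)))
     else (\<Sum>i\<in>UNIV. cmod (u $ i) powr real_of_ereal q) powr (1 / real_of_ereal q))"

definition conj_transpose :: "complex ^ 'n ^ 'm \<Rightarrow> complex ^ 'm ^ 'n" where
  "conj_transpose A = (\<chi> i j. cnj (A $ j $ i))"

definition k_Hadamard :: "real \<Rightarrow> complex ^ 'n ^ 'm \<Rightarrow> bool" where
  "k_Hadamard k A \<longleftrightarrow>
    0 < k \<and>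
    (\<forall>i j. cmod (A $ i $ j) \<le> 1) \<and>
    (\<forall>v. lq_norm \<infinity> ((conj_transpose A ** A) *v v) \<ge> k * lq_norm \<infinity> v)"

end

theory Submission imports Defs begin

text \<open>
  A matrix whose entries have absolute value at most \<open>1\<close> is a contraction from the
  \<open>1\<close>-norm to the maximum norm. Both \<open>A\<close> and its conjugate transpose are of this kind, so
  \<open>\<parallel>Av\<parallel>\<^sub>\<infinity> \<le> \<parallel>v\<parallel>\<^sub>1\<close> and \<open>k \<parallel>v\<parallel>\<^sub>\<infinity> \<le> \<parallel>A\<^sup>*Av\<parallel>\<^sub>\<infinity> \<le> \<parallel>Av\<parallel>\<^sub>1\<close>: the
  maximum norm of each of \<open>v\<close> and \<open>Av\<close> is bounded by the \<open>1\<close>-norm of the other, up to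
  the factor \<open>k\<close>. The case \<open>q = \<infinity>\<close> is the product of these two bounds, and the other cases come from it through the interpolation
  \<open>\<parallel>u\<parallel>\<^sub>q \<le> \<parallel>u\<parallel>\<^sub>1\<^bsup>1/q\<^esup> \<parallel>u\<parallel>\<^sub>\<infinity>\<^bsup>1-1/q\<^esup>\<close>, applied to \<open>u = v\<close> and to \<open>u = Av\<close>.
\<close>

lemma lq_norm_1: "lq_norm 1 u = (\<Sum>i\<in>UNIV. cmod (u $ i))"
  by (simp add: lq_norm_def sum_nonneg)

lemma lq_norm_infinity: "lq_norm \<infinity> u = Max (range (\<lambda>i. cmod (u $ i)))"
  by (simp add: lq_norm_def)

lemma cmod_le_lq_norm_infinity: "cmod (u $ i) \<le> lq_norm \<infinity> u"
  by (simp add: lq_norm_infinity)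

lemma lq_norm_infinity_le_iff: "lq_norm \<infinity> u \<le> c \<longleftrightarrow> (\<forall>i. cmod (u $ i) \<le> c)"
  by (simp add: lq_norm_infinity)

lemma lq_norm_infinity_pos:
  assumes "u \<noteq> 0"
  shows "0 < lq_norm \<infinity> u"
proof -
  obtain i where "u $ i \<noteq> 0"
    using assms by (auto simp: vec_eq_iff)
  then show ?thesis
    using cmod_le_lq_norm_infinity[of u i] by (meson less_le_trans zero_less_norm_iff)
qed

lemma lq_norm_nonneg: "0 \<le> lq_norm q u"
proof (cases "q = \<infinity>")
  case True
  show ?thesis
    unfolding True using cmod_le_lq_norm_infinity norm_ge_zero order_trans by blast
qed (simp add: lq_norm_def)

lemma lq_norm_infinity_mult_le_lq_norm_1:
  assumes "\<And>i j. cmod (B $ i $ j) \<le> 1"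
  shows "lq_norm \<infinity> (B *v w) \<le> lq_norm 1 w"
  unfolding lq_norm_infinity_le_iff
proof
  fix i
  have "cmod ((B *v w) $ i) \<le> (\<Sum>j\<in>UNIV. cmod (B $ i $ j * w $ j))"
    by (simp add: matrix_vector_mult_def norm_sum)
  also have "\<dots> \<le> (\<Sum>j\<in>UNIV. cmod (w $ j))"
    using assms by (intro sum_mono) (simp add: norm_mult mult_left_le_one_le)
  finally show "cmod ((B *v w) $ i) \<le> lq_norm 1 w"
    by (simp add: lq_norm_1)
qed

text \<open>
  For finite \<open>q\<close>, in \<open>\<bar>u\<^sub>i\<bar>\<^sup>q = \<bar>u\<^sub>i\<bar> \<bar>u\<^sub>i\<bar>\<^bsup>q-1\<^esup>\<close> the second factor is at most its value at the
  maximum; then sum over \<open>i\<close>. A nonzero \<open>u\<close> has positive norms, so \<open>powr\<close> takes the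
  usual value \<open>1\<close> at the exponent \<open>0\<close> that occurs for \<open>q = 1\<close> and \<open>q = \<infinity>\<close>.
\<close>

lemma lq_norm_interpolation:
  assumes "1 \<le> q" and "u \<noteq> 0"
  shows "lq_norm q u
    \<le> lq_norm 1 u powr real_of_ereal (1 / q) * lq_norm \<infinity> u powr (1 - real_of_ereal (1 / q))"
proof -
  let ?M = "lq_norm \<infinity> u"
  have M: "0 < ?M"
    by (rule lq_norm_infinity_pos) fact
  show ?thesis
  proof (cases q)
    case (real r)
    have r: "1 \<le> r"
      using assms(1) real by simp
    have term_bound: "cmod (u $ i) powr r \<le> cmod (u $ i) * ?M powr (r - 1)" for i
    proof (cases "u $ i = 0")
      case False
      then have "cmod (u $ i) powr r = cmod (u $ i) * cmod (u $ i) powr (r - 1)"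
        by (simp add: powr_diff)
      also have "\<dots> \<le> cmod (u $ i) * ?M powr (r - 1)"
        using r by (intro mult_left_mono powr_mono2 cmod_le_lq_norm_infinity) auto
      finally show ?thesis .
    qed simp
    have "lq_norm q u = (\<Sum>i\<in>UNIV. cmod (u $ i) powr r) powr (1 / r)"
      by (simp add: lq_norm_def real)
    also have "\<dots> \<le> (\<Sum>i\<in>UNIV. cmod (u $ i) * ?M powr (r - 1)) powr (1 / r)"
      using r by (intro powr_mono2 sum_mono term_bound sum_nonneg) auto
    also have "\<dots> = (lq_norm 1 u * ?M powr (r - 1)) powr (1 / r)"
      by (simp add: lq_norm_1 sum_distrib_right)
    also have "\<dots> = lq_norm 1 u powr (1 / r) * ?M powr ((r - 1) * (1 / r))"
      by (simp add: powr_mult powr_powr lq_norm_nonneg)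
    also have "(r - 1) * (1 / r) = 1 - 1 / r"
      using r by (simp add: field_simps)
    finally show ?thesis
      using r real by (simp add: one_ereal_def)
  next
    case PInf
    have "?M \<le> lq_norm 1 u"
      by (auto simp: lq_norm_infinity_le_iff lq_norm_1 intro: member_le_sum)
    then show ?thesis
      using M PInf by simp
  next
    case MInf
    then show ?thesis
      using assms(1) by simp
  qed
qed

text \<open>
  This is the quantitative injectivity that the Hadamard condition provides: the conjugate
  transpose has the same entry bound as \<open>A\<close>, so \<open>\<parallel>A\<^sup>*Av\<parallel>\<^sub>\<infinity>\<close> cannot exceed \<open>\<parallel>Av\<parallel>\<^sub>1\<close>.
\<close>

lemma k_Hadamard_lower_bound:
  assumes "k_Hadamard k A"
  shows "k * lq_norm \<infinity> v \<le> lq_norm 1 (A *v v)"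
proof -
  have "k * lq_norm \<infinity> v \<le> lq_norm \<infinity> (conj_transpose A *v (A *v v))"
    using assms by (simp add: k_Hadamard_def matrix_vector_mul_assoc)
  also have "\<dots> \<le> lq_norm 1 (A *v v)"
    using assms
    by (intro lq_norm_infinity_mult_le_lq_norm_1) (simp add: k_Hadamard_def conj_transpose_def)
  finally show ?thesis .
qed

theorem theorem3p21:
  fixes k :: real and A :: "complex ^ 'n ^ 'm" and v :: "complex ^ 'n" and q :: ereal
  assumes "0 < k"
    and "k_Hadamard k A"
    and "v \<noteq> 0"
    and "1 \<le> q"
  shows "lq_norm 1 v * lq_norm 1 (A *v v)
    \<ge> k powr (1 - real_of_ereal (1 / q)) * lq_norm q v * lq_norm q (A *v v)"
proof -
  define s where "s = real_of_ereal (1 / q)"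
  have s: "s \<le> 1"
    using \<open>1 \<le> q\<close> unfolding s_def by (cases q) (auto simp: one_ereal_def)
  let ?a = "lq_norm 1 v" and ?b = "lq_norm 1 (A *v v)"
  let ?M = "lq_norm \<infinity> v" and ?N = "lq_norm \<infinity> (A *v v)"
  have lower: "k * ?M \<le> ?b"
    by (rule k_Hadamard_lower_bound) fact
  have upper: "?N \<le> ?a"
    using \<open>k_Hadamard k A\<close>
    by (intro lq_norm_infinity_mult_le_lq_norm_1) (simp add: k_Hadamard_def)
  have kM: "0 < k * ?M"
    using \<open>0 < k\<close> lq_norm_infinity_pos[OF \<open>v \<noteq> 0\<close>] by simp
  have Av: "A *v v \<noteq> 0"
    using lower kM by (auto simp: lq_norm_1)
  have "k powr (1 - s) * lq_norm q v * lq_norm q (A *v v)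
      \<le> k powr (1 - s) * (?a powr s * ?M powr (1 - s)) * (?b powr s * ?N powr (1 - s))"
    unfolding s_def
    by (intro mult_mono mult_left_mono lq_norm_interpolation \<open>1 \<le> q\<close> \<open>v \<noteq> 0\<close> Av)
      (auto simp: lq_norm_nonneg)
  also have "\<dots> = ?a powr s * ?b powr s * ((k * ?M) powr (1 - s) * ?N powr (1 - s))"
    using \<open>0 < k\<close> by (simp add: powr_mult lq_norm_nonneg mult_ac)
  also have "\<dots> \<le> ?a powr s * ?b powr s * (?b powr (1 - s) * ?a powr (1 - s))"
    using lower upper kM s
    by (intro mult_left_mono mult_mono powr_mono2) (auto simp: lq_norm_nonneg)
  also have "\<dots> = (?a powr s * ?a powr (1 - s)) * (?b powr s * ?b powr (1 - s))"
    by (simp add: mult_ac)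
  also have "\<dots> = ?a * ?b"
    by (simp add: lq_norm_nonneg flip: powr_add)
  finally show ?thesis
    by (simp add: s_def)
qed

end
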